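(* Let $n \geqslant m \geqslant 1$ be integers and let $\sigma^m = [\upsilon^0, \upsilon^1, \ldots, \upsilon^m]$ be an $m$-simplex in $\mathbb{R}^n$ with barycenter $\kappa^m$. For $i=0,\ldots,m$ let $\kappa_i^m$ be the barycenter of the $i$-th $(m-1)$-face of $\sigma^m$ (opposite to $\upsilon^i$) and let $\mu_i^m=[\kappa_i^m,\upsilon^i]$ be the $i$-th median. Then the $m+1$ medians of $\sigma^m$ concur in the barycenter $\kappa^m$, which divides each of them in the ratio $1:m$, the longer segment being on the side of the vertex; that is, for every $i=0,\ldots,m$ the point $\kappa^m$ lies on the segment $\mu_i^m$ and $\|\kappa^m-\upsilon^i\| = m\,\|\kappa_i^m-\kappa^m\|$.
   Context: An $m$-simplex $[\upsilon^0,\ldots,\upsilon^m]$ in $\mathbb{R}^n$ is the convex hull of $m+1$ affinely independent points (its vertices). Its barycenter is $\kappa^m=\frac1{m+1}\sum_{j=0}^m\upsilon^j$. The $i$-th $(m-1)$-face is the convex hull of all vertices except $\upsilon^i$, and its barycenter is $\kappa_i^m = \frac1m\sum_{j\neq i}\upsilon^j$. The $i$-th median is the segment joining $\upsilon^i$ and $\kappa_i^m$. $\|\cdot\|$ is the Euclidean norm. *)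

theory Defs
  imports "HOL-Analysis.Analysis"
begin

text \<open>
  The vertices are a family indexed by \<open>{0..m}\<close>, so that faces and medians can be numbered.
  Since \<^const>\<open>affine_dependent\<close> is a predicate on sets, injectivity is needed
  to say that the \<open>m + 1\<close> points are pairwise distinct.
\<close>

definition simplex_with_vertices ::
    "nat \<Rightarrow> (nat \<Rightarrow> real ^ 'n) \<Rightarrow> (real ^ 'n) set \<Rightarrow> bool" where
  "simplex_with_vertices m v S \<longleftrightarrow>
     inj_on v {0..m} \<and> \<not> affine_dependent (v ` {0..m}) \<and> S = convex hull (v ` {0..m})"

lemma simplex_with_vertices_imp_simplex:
  assumes "simplex_with_vertices m v S"
  shows "int m simplex S"
  unfolding simplex_def
  using assms unfolding simplex_with_vertices_def
  by (intro exI[of _ "v ` {0..m}"]) (simp add: card_image)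

definition barycenter :: "nat \<Rightarrow> (nat \<Rightarrow> real ^ 'n) \<Rightarrow> real ^ 'n" where
  "barycenter m v = (1 / (real m + 1)) *\<^sub>R (\<Sum>j\<in>{0..m}. v j)"

definition face_barycenter :: "nat \<Rightarrow> (nat \<Rightarrow> real ^ 'n) \<Rightarrow> nat \<Rightarrow> real ^ 'n" where
  "face_barycenter m v i = (1 / real m) *\<^sub>R (\<Sum>j\<in>{0..m} - {i}. v j)"

definition median :: "nat \<Rightarrow> (nat \<Rightarrow> real ^ 'n) \<Rightarrow> nat \<Rightarrow> (real ^ 'n) set" where
  "median m v i = closed_segment (face_barycenter m v i) (v i)"

end

theory Submission
  imports Defs
begin

text \<open>Splitting the sum of all vertices at index \<open>i\<close> gives the vector identity of
  \<open>barycenter_eq_face_barycenter\<close>: (m+1) times the barycenter is m times the face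
  barycenter plus the opposite vertex. Dividing by m+1 exhibits the barycenter as a convex
  combination of the endpoints of the median; rearranging instead gives the ratio.\<close>

lemma barycenter_eq_face_barycenter:
  fixes v :: "nat \<Rightarrow> real ^ 'n"
  assumes "1 \<le> m" and "i \<in> {0..m}"
  shows "(real m + 1) *\<^sub>R barycenter m v = real m *\<^sub>R face_barycenter m v i + v i"
proof -
  have "(real m + 1) *\<^sub>R barycenter m v = (\<Sum>j\<in>{0..m}. v j)"
    by (simp add: barycenter_def add_eq_0_iff)
  also have "\<dots> = v i + (\<Sum>j\<in>{0..m} - {i}. v j)"
    using assms(2) by (simp add: sum.remove)
  also have "(\<Sum>j\<in>{0..m} - {i}. v j) = real m *\<^sub>R face_barycenter m v i"
    using assms(1) by (simp add: face_barycenter_def)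
  finally show ?thesis
    by (simp add: add.commute)
qed

lemma barycenter_in_median:
  fixes v :: "nat \<Rightarrow> real ^ 'n"
  assumes "1 \<le> m" and "i \<in> {0..m}"
  shows "barycenter m v \<in> median m v i"
proof -
  \<comment> \<open>The weight of the vertex; the face barycenter gets m/(m+1). In
    \<open>in_segment\<close> the parameter weights the second endpoint, which in
    \<open>median\<close> is the vertex.\<close>
  let ?u = "1 / (real m + 1)"
  have u: "1 - ?u = ?u * real m" "?u * (real m + 1) = 1"
    by (simp_all add: field_simps)
  have "barycenter m v = ?u *\<^sub>R ((real m + 1) *\<^sub>R barycenter m v)"
    by (simp only: scaleR_scaleR u scaleR_one)
  also have "\<dots> = (1 - ?u) *\<^sub>R face_barycenter m v i + ?u *\<^sub>R v i"
    by (simp only: barycenter_eq_face_barycenter[OF assms] scaleR_add_right scaleR_scaleR u)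
  finally have "barycenter m v = (1 - ?u) *\<^sub>R face_barycenter m v i + ?u *\<^sub>R v i" .
  moreover have "0 \<le> ?u" "?u \<le> 1"
    by simp_all
  ultimately show ?thesis
    unfolding median_def in_segment by blast
qed

text \<open>The two difference vectors are already proportional with the nonnegative factor m, so
  taking norms suffices.\<close>

lemma norm_barycenter_diff_vertex:
  fixes v :: "nat \<Rightarrow> real ^ 'n"
  assumes "1 \<le> m" and "i \<in> {0..m}"
  shows "norm (barycenter m v - v i) = real m * norm (face_barycenter m v i - barycenter m v)"
proof -
  \<comment> \<open>Move m copies of the barycenter to one side and the vertex to the other.\<close>
  have "barycenter m v - v i = real m *\<^sub>R (face_barycenter m v i - barycenter m v)"
    using barycenter_eq_face_barycenter[OF assms, of v] by (simp add: algebra_simps)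
  then show ?thesis
    by simp
qed

theorem theorem2p23:
  fixes v :: "nat \<Rightarrow> real ^ 'n" and m :: nat and \<sigma> :: "(real ^ 'n) set"
  assumes "1 \<le> m" and "m \<le> CARD('n)"
    and "simplex_with_vertices m v \<sigma>"
  shows "\<forall>i\<in>{0..m}. barycenter m v \<in> median m v i \<and>
           norm (barycenter m v - v i) = real m * norm (face_barycenter m v i - barycenter m v)"
  using assms(1) barycenter_in_median norm_barycenter_diff_vertex by blast

end
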